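(* Let $X$ be a real Banach space. If $X$ is locally uniformly nonsquare (LUNSQ), then $X$ does not have $\Delta$-points.
   Context: $B_X$ and $S_X$ denote the closed unit ball and unit sphere. A point $x\in S_X$ is a locally uniformly nonsquare point if there exists $\delta>0$ such that $\min\{\|x+y\|,\|x-y\|\}\le 2-\delta$ for all $y\in S_X$. $X$ is locally uniformly nonsquare (LUNSQ) if every point of $S_X$ is a locally uniformly nonsquare point. For $x\in S_X$ and $\epsilon>0$ let $\Delta_\epsilon(x)=\{y\in B_X:\|x-y\|\ge 2-\epsilon\}$. A point $x\in S_X$ is a $\Delta$-point if $x\in\overline{\mathrm{conv}}\,\Delta_\epsilon(x)$ for every $\epsilon>0$. *)

theory Defs
  imports "HOL-Analysis.Analysis"
begin

definition lunsq_point :: "'a::real_normed_vector \<Rightarrow> bool" where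
  "lunsq_point x \<longleftrightarrow> x \<in> sphere 0 1 \<and>
     (\<exists>\<delta>>0. \<forall>y \<in> sphere 0 1. min (norm (x + y)) (norm (x - y)) \<le> 2 - \<delta>)"

text \<open>The space is the whole type, passed as in \<open>LUNSQ TYPE('a)\<close>.\<close>

definition LUNSQ :: "'a::real_normed_vector itself \<Rightarrow> bool" where
  "LUNSQ _ \<longleftrightarrow> (\<forall>x \<in> sphere (0::'a) 1. lunsq_point x)"

definition Delta_set :: "real \<Rightarrow> 'a::real_normed_vector \<Rightarrow> 'a set" where
  "Delta_set \<epsilon> x = {y \<in> cball 0 1. norm (x - y) \<ge> 2 - \<epsilon>}"

definition Delta_point :: "'a::real_normed_vector \<Rightarrow> bool" where
  "Delta_point x \<longleftrightarrow> x \<in> sphere 0 1 \<and>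
     (\<forall>\<epsilon>>0. x \<in> closure (convex hull (Delta_set \<epsilon> x)))"

end

theory Submission
  imports Defs
begin

text \<open>The function \<open>z \<mapsto> norm (x + z)\<close> is convex and continuous and takes the value 2 at the
  point \<open>x\<close>, so if \<open>x\<close> lies in the closed convex hull of a set, some point \<open>y\<close> of that set has
  \<open>norm (x + y)\<close> close to 2. For a set of points almost at distance 2 from \<open>x\<close>, normalizing \<open>y\<close>
  then contradicts nonsquareness at \<open>x\<close>.\<close>

lemma closure_convex_hull_norm_add:
  fixes x :: "'a::real_normed_vector"
  assumes "x \<in> closure (convex hull A)" and "r < 2 * norm x"
  shows "\<exists>y\<in>A. r < norm (x + y)"
proof (rule ccontr)
  assume "\<not> ?thesis"
  \<comment> \<open>The ball about \<open>- x\<close> is closed and convex, so it absorbs the closed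
    convex hull of \<open>A\<close> and hence contains \<open>x\<close> itself.\<close>
  then have "A \<subseteq> cball (- x) r"
    by (force simp: dist_norm norm_minus_commute[of "- x"] add.commute)
  then have "closure (convex hull A) \<subseteq> cball (- x) r"
    by (intro closure_minimal hull_minimal) auto
  then have "norm (x + x) \<le> r"
    using assms(1) by (force simp: dist_norm norm_minus_commute[of "- x"])
  then show False
    using assms(2) by (simp flip: scaleR_2)
qed

lemma Delta_point_not_lunsq_point:
  assumes "Delta_point x"
  shows "\<not> lunsq_point x"
proof
  assume "lunsq_point x"
  then obtain \<delta> where \<delta>: "\<delta> > 0"
    and nsq: "\<And>y. norm y = 1 \<Longrightarrow> min (norm (x + y)) (norm (x - y)) \<le> 2 - \<delta>"
    unfolding lunsq_point_def by auto
  have x: "norm x = 1"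
    using assms by (simp add: Delta_point_def)
  \<comment> \<open>Each norm falls short of 2 by at most \<open>\<epsilon>\<close>, and normalizing
    \<open>y\<close> costs at most another \<open>\<epsilon>\<close>, so
    \<open>2 * \<epsilon>\<close> must stay below \<open>\<delta>\<close>. The cap at 1 keeps
    \<open>y\<close> away from 0.\<close>
  define \<epsilon> where "\<epsilon> = min \<delta> 1 / 3"
  have \<epsilon>: "0 < \<epsilon>" "\<epsilon> < 1" "2 * \<epsilon> < \<delta>"
    using \<delta> by (auto simp: \<epsilon>_def)
  have "x \<in> closure (convex hull (Delta_set \<epsilon> x))"
    using assms \<epsilon>(1) by (simp add: Delta_point_def)
  then obtain y where "y \<in> Delta_set \<epsilon> x" and plus: "2 - \<epsilon> < norm (x + y)"
    using closure_convex_hull_norm_add[of x _ "2 - \<epsilon>"] x \<epsilon>(1) by auto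
  then have y: "norm y \<le> 1" and minus: "2 - \<epsilon> \<le> norm (x - y)"
    by (auto simp: Delta_set_def)
  have y': "1 - \<epsilon> < norm y"
    using norm_triangle_ineq[of x y] plus x by linarith
  then have "y \<noteq> 0"
    using \<epsilon>(2) by auto
  \<comment> \<open>\<open>sgn y\<close> is the radial projection of \<open>y\<close> to the sphere;
    it moves \<open>y\<close> by \<open>1 - norm y\<close>, which is less than
    \<open>\<epsilon>\<close>.\<close>
  have "sgn y - y = (1 - norm y) *\<^sub>R sgn y"
    using \<open>y \<noteq> 0\<close> by (simp add: sgn_div_norm algebra_simps)
  then have "norm (sgn y - y) = 1 - norm y"
    using y \<open>y \<noteq> 0\<close> by (simp add: norm_sgn)
  then have "norm (x + y) \<le> norm (x + sgn y) + \<epsilon>" "norm (x - y) \<le> norm (x - sgn y) + \<epsilon>"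
    using norm_triangle_ineq4[of "x + sgn y" "sgn y - y"]
      norm_triangle_ineq[of "x - sgn y" "sgn y - y"] y' by auto
  then show False
    \<comment> \<open>Both \<open>norm (x + sgn y)\<close> and \<open>norm (x - sgn y)\<close> are
      at least \<open>2 - 2 * \<epsilon>\<close>, which exceeds \<open>2 - \<delta>\<close>.\<close>
    using nsq[of "sgn y"] \<open>y \<noteq> 0\<close> plus minus \<epsilon>(3) by (auto simp: norm_sgn min_def split: if_splits)
qed

theorem corollary4p3:
  assumes "LUNSQ TYPE('a::banach)"
  shows "\<not> (\<exists>x::'a. Delta_point x)"
proof
  assume "\<exists>x::'a. Delta_point x"
  then obtain x :: 'a where "Delta_point x" ..
  moreover from this have "lunsq_point x"
    using assms by (simp add: LUNSQ_def Delta_point_def)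
  ultimately show False
    using Delta_point_not_lunsq_point by blast
qed

end
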